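(* Let $\mathbf{c}=(c_0,c_1,\dots,c_n)\in\mathfrak{C}_+$ and $P\in\mathfrak{P}_+$. Let $N_0>n$ be such that $\mathbf{c}\in\mathfrak{C}_+(N)$ for all $N\ge N_0$. For any $N\ge N_0$, let $Q_N\in\mathfrak{P}_+(N)$ be the unique solution in $\mathfrak{P}_+(N)$ of $$c_k=\frac{1}{2N}\sum_{j=-N+1}^{N}\zeta_{j}^{k}\,\frac{P(\zeta_{j})}{Q_N(\zeta_{j})},\qquad k=0,1,\dots,n,\qquad \zeta_{j}=e^{i\pi j/N},$$ and let $Q\in\mathfrak{P}_+$ be the unique solution in $\mathfrak{P}_+$ of $$c_k=\int_{-\pi}^{\pi}e^{ik\theta}\,\frac{P(e^{i\theta})}{Q(e^{i\theta})}\,\frac{d\theta}{2\pi},\qquad k=0,1,\dots,n.$$ Then $Q_N\to Q$ as $N\to\infty$.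
   Context: Let $n$ be a positive integer; $N$ ranges over integers $N>n$. For each $N$ let $\zeta_j=e^{i\pi j/N}$, $j=-N+1,\dots,N$ (the $2N$-th roots of unity). Let $\mathfrak{P}$ be the finite-dimensional real vector space of symmetric trigonometric polynomials $P(\zeta)=\sum_{k=-n}^{n}p_k\zeta^{-k}$, with $p_k\in\mathbb{C}$, $p_{-k}=\overline{p_k}$; convergence is in this finite-dimensional space. Put $$\mathfrak{P}_+=\{P\in\mathfrak{P}: P(e^{i\theta})>0\ \text{for all }\theta\in[-\pi,\pi]\},\qquad \mathfrak{P}_+(N)=\{P\in\mathfrak{P}: P(\zeta_j)>0,\ j=-N+1,\dots,N\},$$ with closures $\overline{\mathfrak{P}_+}$, $\overline{\mathfrak{P}_+(N)}$ in $\mathfrak{P}$. For $\mathbf{c}=(c_0,c_1,\dots,c_n)$ with $c_0$ real and $c_1,\dots,c_n$ complex, put $c_{-k}=\overline{c_k}$ and $\langle C,P\rangle=\sum_{k=-n}^{n}c_k\overline{p_k}$. The (open) dual cones are $$\mathfrak{C}_+=\{\mathbf{c}: \langle C,P\rangle>0\ \text{for all } P\in\overline{\mathfrak{P}_+}\setminus\{0\}\},\qquad \mathfrak{C}_+(N)=\{\mathbf{c}: \langle C,P\rangle>0\ \text{for all } P\in\overline{\mathfrak{P}_+(N)}\setminus\{0\}\}.$$ For $\mathbf{c}\in\mathfrak{C}_+$ such an $N_0$ exists, and both moment problems in the claim have exactly one solution in the indicated cones. *)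

theory Defs
  imports "HOL-Analysis.Analysis"
begin

text \<open>
  A trigonometric polynomial of degree at most \<open>n\<close> is given by its coefficient
  function on the integers, zero outside \<open>{-n..n}\<close>.  The type \<open>int \<Rightarrow> complex\<close>
  carries the product topology; \<open>trig_polys n\<close> is a closed subset of it
  (lemma \<open>closed_trig_polys\<close>) and inherits the usual topology of a finite-dimensional
  space (coefficientwise convergence).  Hence \<open>closure\<close> and limits taken in
  \<open>int \<Rightarrow> complex\<close> agree with those in \<open>trig_polys n\<close>.
\<close>

definition trig_polys :: "nat \<Rightarrow> (int \<Rightarrow> complex) set" where
  "trig_polys n = {p. (\<forall>k. p (- k) = cnj (p k)) \<and> (\<forall>k. \<bar>k\<bar> > int n \<longrightarrow> p k = 0)}"

definition trig_eval :: "nat \<Rightarrow> (int \<Rightarrow> complex) \<Rightarrow> complex \<Rightarrow> complex" where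
  "trig_eval n p z = (\<Sum>k\<in>{- int n..int n}. p k * z powi (- k))"

definition zeta :: "nat \<Rightarrow> int \<Rightarrow> complex" where
  "zeta N j = cis (pi * real_of_int j / real N)"

text \<open>
  Values on the unit circle are real (lemma \<open>trig_eval_real\<close>), so positivity is
  positivity of the real part.
\<close>

definition trig_pos :: "nat \<Rightarrow> (int \<Rightarrow> complex) set" where
  "trig_pos n = {p \<in> trig_polys n. \<forall>\<theta>\<in>{-pi..pi}. Re (trig_eval n p (cis \<theta>)) > 0}"

definition trig_pos_disc :: "nat \<Rightarrow> nat \<Rightarrow> (int \<Rightarrow> complex) set" where
  "trig_pos_disc n N =
     {p \<in> trig_polys n. \<forall>j\<in>{- int N + 1..int N}. Re (trig_eval n p (zeta N j)) > 0}"

text \<open>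
  A tuple \<open>(c\<^sub>0, \<dots>, c\<^sub>n)\<close> is a function on the naturals that vanishes beyond \<open>n\<close>;
  \<open>herm_ext\<close> extends it to negative indices.
\<close>

definition moment_vectors :: "nat \<Rightarrow> (nat \<Rightarrow> complex) set" where
  "moment_vectors n = {c. c 0 \<in> \<real> \<and> (\<forall>k>n. c k = 0)}"

definition herm_ext :: "(nat \<Rightarrow> complex) \<Rightarrow> int \<Rightarrow> complex" where
  "herm_ext c k = (if k \<ge> 0 then c (nat k) else cnj (c (nat (- k))))"

definition pairing :: "nat \<Rightarrow> (nat \<Rightarrow> complex) \<Rightarrow> (int \<Rightarrow> complex) \<Rightarrow> complex" where
  "pairing n c p = (\<Sum>k\<in>{- int n..int n}. herm_ext c k * cnj (p k))"

text \<open>The pairing is real as well (lemma \<open>pairing_real\<close>).\<close>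

definition dual_cone :: "nat \<Rightarrow> (int \<Rightarrow> complex) set \<Rightarrow> (nat \<Rightarrow> complex) set" where
  "dual_cone n K =
     {c \<in> moment_vectors n. \<forall>p \<in> closure K - {\<lambda>_. 0}. Re (pairing n c p) > 0}"

definition dual_pos :: "nat \<Rightarrow> (nat \<Rightarrow> complex) set" where
  "dual_pos n = dual_cone n (trig_pos n)"

definition dual_pos_disc :: "nat \<Rightarrow> nat \<Rightarrow> (nat \<Rightarrow> complex) set" where
  "dual_pos_disc n N = dual_cone n (trig_pos_disc n N)"

definition solves_moments ::
  "nat \<Rightarrow> (nat \<Rightarrow> complex) \<Rightarrow> (int \<Rightarrow> complex) \<Rightarrow> (int \<Rightarrow> complex) \<Rightarrow> bool" where
  "solves_moments n c p q \<longleftrightarrow>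
     (\<forall>k\<le>n. c k = integral {-pi..pi} (\<lambda>\<theta>. cis (real k * \<theta>) *
                 (trig_eval n p (cis \<theta>) / trig_eval n q (cis \<theta>)) / complex_of_real (2 * pi)))"

definition solves_moments_disc ::
  "nat \<Rightarrow> nat \<Rightarrow> (nat \<Rightarrow> complex) \<Rightarrow> (int \<Rightarrow> complex) \<Rightarrow> (int \<Rightarrow> complex) \<Rightarrow> bool" where
  "solves_moments_disc n N c p q \<longleftrightarrow>
     (\<forall>k\<le>n. c k = 1 / of_nat (2 * N) *
        (\<Sum>j\<in>{- int N + 1..int N}. zeta N j ^ k *
            (trig_eval n p (zeta N j) / trig_eval n q (zeta N j))))"

lemma trig_eval_real:
  assumes "p \<in> trig_polys n" "norm z = 1"
  shows "trig_eval n p z \<in> \<real>"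
proof -
  have z: "cnj z = inverse z"
    using assms(2) by (metis complex_cnj_cnj complex_div_cnj complex_norm_square 
        div_by_1 inverse_eq_divide mult_1 of_real_1 one_power2)
  have "cnj (trig_eval n p z) = (\<Sum>k\<in>{- int n..int n}. p (- k) * z powi k)"
    using assms(1) unfolding trig_eval_def trig_polys_def
    by (simp add: z power_int_inverse power_int_minus)
  also have "\<dots> = trig_eval n p z"
    unfolding trig_eval_def
    by (rule sum.reindex_bij_witness[of _ uminus uminus]) auto
  finally show ?thesis by (simp add: Reals_cnj_iff)
qed

lemma pairing_real:
  assumes "c \<in> moment_vectors n" "p \<in> trig_polys n"
  shows "pairing n c p \<in> \<real>"
proof -
  have h: "cnj (herm_ext c k) = herm_ext c (- k)" for k
    using assms(1) by (auto simp: herm_ext_def moment_vectors_def Reals_cnj_iff)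
  have "cnj (pairing n c p) = (\<Sum>k\<in>{- int n..int n}. herm_ext c (- k) * cnj (p (- k)))"
    using assms(2) unfolding pairing_def trig_polys_def by (simp add: h)
  also have "\<dots> = pairing n c p"
    unfolding pairing_def
    by (rule sum.reindex_bij_witness[of _ uminus uminus]) auto
  finally show ?thesis by (simp add: Reals_cnj_iff)
qed

lemma closed_trig_polys: "closed (trig_polys n)"
proof -
  have c: "continuous_on UNIV (\<lambda>p :: int \<Rightarrow> complex. p k)" for k
    by (intro continuous_on_product_coordinates)
  show ?thesis
    unfolding trig_polys_def
    by (intro closed_Collect_conj closed_Collect_all closed_Collect_imp closed_Collect_eq
        open_Collect_const continuous_on_cnj continuous_on_const c)
qed

end

theory Submission
  imports Defs
begin

text \<open>
  The convergence follows from a quantitative stability estimate for the moment problem on the nodes.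

  Write \<open>\<langle>f\<rangle>\<close> for the mean of \<open>f\<close> over the \<open>2N\<close>-th roots of unity, \<open>D = Q - Q\<^sub>N\<close>, and let \<open>S\<close> be
  the \<open>\<ell>\<^sup>1\<close> norm of the coefficients of \<open>D\<close>.  Both \<open>P/Q\<^sub>N\<close>, sampled at the nodes, and \<open>P/Q\<close>,
  integrated over the circle, have the moments \<open>c\<^sub>k\<close>.  Sampling \<open>P/Q\<close> at the nodes instead changes
  its moments by a total \<open>\<delta>\<^sub>N\<close>, which tends to \<open>0\<close> because the sampled moments are Riemann sums
  (\<open>sampled_moment_tendsto\<close>).  The moments up to \<open>n\<close> determine the mean against any trigonometric
  polynomial of degree at most \<open>n\<close> (\<open>norm_mean_mult_trig_eval_le\<close>), and testing against \<open>D\<close> itself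
  produces a positive quantity:
  \<open>\<langle>P D\<^sup>2 / (Q Q\<^sub>N)\<rangle> = \<langle>(P/Q\<^sub>N - P/Q) D\<rangle> \<le> S \<delta>\<^sub>N\<close>.

  On the left, \<open>P\<close> is bounded below by some \<open>m > 0\<close>, and at the nodes \<open>Q \<le> B\<close> and
  \<open>Q\<^sub>N = Q - D \<le> B + S\<close>, where \<open>B\<close> is the coefficient norm of \<open>Q\<close>.  As \<open>N > n\<close>, the samples of \<open>D\<close>
  determine its coefficients, and \<open>S\<^sup>2 \<le> (2n+1)\<^sup>2 \<langle>D\<^sup>2\<rangle>\<close> (\<open>coeff_norm_squared_le_mean_square\<close>).
  Together these give \<open>m S \<le> (2n+1)\<^sup>2 B (B + S) \<delta>\<^sub>N\<close> (\<open>coeff_norm_diff_le_moment_diff\<close>).  The right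
  side is only linear in \<open>S\<close>, so once \<open>\<delta>\<^sub>N\<close> is small its \<open>S\<close>-part is absorbed on the left and
  \<open>S = O(\<delta>\<^sub>N)\<close>.  That \<open>Q\<^sub>N\<close> may come close to \<open>0\<close> at the nodes does no harm, since small values of
  \<open>Q\<^sub>N\<close> only increase the left side, and its values between the nodes do not enter.
\<close>

section \<open>Riemann sums on the circle\<close>

text \<open>
  Each added subinterval contributes an error of at most \<open>e * h\<close>, since on it \<open>f\<close> stays within \<open>e\<close> of
  its value at the right endpoint.  Right endpoints are used because the nodes
  \<open>\<pi> j / N\<close> with \<open>-N < j \<le> N\<close> are the right endpoints of a subdivision of \<open>[-\<pi>, \<pi>]\<close>.
\<close>

lemma integral_right_riemann_sum_error:
  fixes f :: "real \<Rightarrow> 'a::banach"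
  assumes "h \<ge> 0" and "continuous_on {a..a + real m * h} f"
    and "\<And>x y. x \<in> {a..a + real m * h} \<Longrightarrow> y \<in> {a..a + real m * h} \<Longrightarrow> \<bar>x - y\<bar> \<le> h \<Longrightarrow>
           norm (f x - f y) \<le> e"
  shows "norm (integral {a..a + real m * h} f - (\<Sum>i<m. h *\<^sub>R f (a + real (Suc i) * h)))
           \<le> e * (real m * h)"
  using assms(2,3)
proof (induction m)
  case 0
  then show ?case by simp
next
  case (Suc m)
  define b where "b = a + real m * h"
  have b: "a \<le> b" "b \<le> b + h" "a + real (Suc m) * h = b + h"
    using \<open>h \<ge> 0\<close> by (auto simp: b_def algebra_simps)
  have cont: "continuous_on {a..b + h} f" using Suc.prems(1) b(3) by simp
  have osc: "norm (f x - f y) \<le> e"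
    if "x \<in> {a..b + h}" "y \<in> {a..b + h}" "\<bar>x - y\<bar> \<le> h" for x y
    using Suc.prems(2) that b(3) by simp
  have cont2: "continuous_on {b..b + h} f"
    using cont by (rule continuous_on_subset) (use b in auto)
  have IH: "norm (integral {a..b} f - (\<Sum>i<m. h *\<^sub>R f (a + real (Suc i) * h))) \<le> e * (real m * h)"
    unfolding b_def
  proof (rule Suc.IH)
    show "continuous_on {a..a + real m * h} f"
      using cont by (rule continuous_on_subset) (use b in \<open>auto simp: b_def\<close>)
    show "norm (f x - f y) \<le> e"
      if "x \<in> {a..a + real m * h}" "y \<in> {a..a + real m * h}" "\<bar>x - y\<bar> \<le> h" for x y
      using that b \<open>h \<ge> 0\<close> by (intro osc) (auto simp: b_def)
  qed
  have "integral {b..b + h} (\<lambda>x. f x - f (b + h)) = integral {b..b + h} f - h *\<^sub>R f (b + h)"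
    using b by (subst Henstock_Kurzweil_Integration.integral_diff)
      (auto intro: integrable_continuous_real cont2)
  moreover have "norm (integral {b..b + h} (\<lambda>x. f x - f (b + h))) \<le> e * (b + h - b)"
    using b by (intro integral_bound continuous_intros cont2 osc) auto
  ultimately have step: "norm (integral {b..b + h} f - h *\<^sub>R f (b + h)) \<le> e * h" by simp
  have "integral {a..b + h} f = integral {a..b} f + integral {b..b + h} f"
    using b cont
    by (intro Henstock_Kurzweil_Integration.integral_combine[symmetric] integrable_continuous_real)
  then have "integral {a..b + h} f - (\<Sum>i<Suc m. h *\<^sub>R f (a + real (Suc i) * h))
     = (integral {a..b} f - (\<Sum>i<m. h *\<^sub>R f (a + real (Suc i) * h)))
       + (integral {b..b + h} f - h *\<^sub>R f (b + h))"
    using b(3) by simp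
  also have "norm \<dots> \<le> e * (real m * h) + e * h"
    by (rule norm_triangle_mono[OF IH step])
  also have "\<dots> = e * (real (Suc m) * h)" by (simp add: algebra_simps)
  finally show ?case unfolding b(3) .
qed

lemma sum_symmetric_int_interval_eq_sum_nat:
  "(\<Sum>j\<in>{- int N + 1..int N}. g j) = (\<Sum>i<2 * N. g (- int N + 1 + int i))"
  by (rule sum.reindex_bij_witness[of _ "\<lambda>i. - int N + 1 + int i" "\<lambda>j. nat (j + int N - 1)"]) auto

lemma equispaced_mean_tendsto_integral:
  fixes f :: "real \<Rightarrow> complex"
  assumes "continuous_on {-pi..pi} f"
  shows "(\<lambda>N. 1 / of_nat (2 * N) * (\<Sum>j\<in>{- int N + 1..int N}. f (pi * real_of_int j / real N)))
           \<longlonglongrightarrow> integral {-pi..pi} (\<lambda>\<theta>. f \<theta> / complex_of_real (2 * pi))"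
proof (rule LIMSEQ_I)
  fix r :: real assume "r > 0"
  have "uniformly_continuous_on {-pi..pi} f"
    using assms by (intro compact_uniformly_continuous) auto
  then obtain d where d: "d > 0"
    "\<And>x y. x \<in> {-pi..pi} \<Longrightarrow> y \<in> {-pi..pi} \<Longrightarrow> dist y x < d \<Longrightarrow> dist (f y) (f x) < r / 2"
    unfolding uniformly_continuous_on_def using \<open>r > 0\<close> by (metis half_gt_zero)
  obtain M :: nat where M: "real M > pi / d" using reals_Archimedean2 by blast
  show "\<exists>M. \<forall>N\<ge>M. norm (1 / of_nat (2 * N) *
        (\<Sum>j\<in>{- int N + 1..int N}. f (pi * real_of_int j / real N))
      - integral {-pi..pi} (\<lambda>\<theta>. f \<theta> / complex_of_real (2 * pi))) < r"
  proof (intro exI[of _ M] allI impI)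
    fix N assume "N \<ge> M"
    have "0 < pi / d" using d by simp
    then have N: "N > 0" "real N > pi / d" using M \<open>N \<ge> M\<close> by linarith+
    define h where "h = pi / real N"
    have h: "h \<ge> 0" "h < d" "-pi + real (2 * N) * h = pi"
      using N d by (auto simp: h_def field_simps)
    have "norm (integral {-pi..-pi + real (2 * N) * h} f
            - (\<Sum>i<2 * N. h *\<^sub>R f (-pi + real (Suc i) * h))) \<le> r / 2 * (real (2 * N) * h)"
    proof (rule integral_right_riemann_sum_error)
      show "continuous_on {-pi..-pi + real (2 * N) * h} f" using assms unfolding h(3) .
      show "norm (f x - f y) \<le> r / 2"
        if "x \<in> {-pi..-pi + real (2 * N) * h}" "y \<in> {-pi..-pi + real (2 * N) * h}"
          "\<bar>x - y\<bar> \<le> h" for x y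
        using that d(2)[of y x] h by (simp add: dist_norm)
    qed (use h in auto)
    moreover have "(\<Sum>i<2 * N. h *\<^sub>R f (-pi + real (Suc i) * h))
        = h *\<^sub>R (\<Sum>j\<in>{- int N + 1..int N}. f (pi * real_of_int j / real N))"
      unfolding sum_symmetric_int_interval_eq_sum_nat scaleR_sum_right
    proof (intro sum.cong refl)
      fix i
      have "-pi + real (Suc i) * h = pi * real_of_int (- int N + 1 + int i) / real N"
        using N by (simp add: h_def field_simps)
      then show "h *\<^sub>R f (-pi + real (Suc i) * h)
          = h *\<^sub>R f (pi * real_of_int (- int N + 1 + int i) / real N)" by simp
    qed
    ultimately have "norm (integral {-pi..pi} f
        - h *\<^sub>R (\<Sum>j\<in>{- int N + 1..int N}. f (pi * real_of_int j / real N))) \<le> r / 2 * (2 * pi)"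
      (is "norm ?E \<le> _") using N by (simp add: h(3)) (simp add: h_def)
    moreover have "1 / of_nat (2 * N) *
        (\<Sum>j\<in>{- int N + 1..int N}. f (pi * real_of_int j / real N))
      - integral {-pi..pi} (\<lambda>\<theta>. f \<theta> / complex_of_real (2 * pi)) = - ?E / complex_of_real (2 * pi)"
      using N by (simp add: h_def scaleR_conv_of_real field_simps)
    moreover have "norm (- ?E / complex_of_real (2 * pi)) = norm ?E / (2 * pi)"
      unfolding norm_divide norm_minus_cancel norm_of_real by simp
    ultimately have "norm (1 / of_nat (2 * N) *
        (\<Sum>j\<in>{- int N + 1..int N}. f (pi * real_of_int j / real N))
      - integral {-pi..pi} (\<lambda>\<theta>. f \<theta> / complex_of_real (2 * pi))) \<le> r / 2 * (2 * pi) / (2 * pi)"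
      by (simp only:) (rule divide_right_mono, simp_all)
    also have "\<dots> = r / 2" by simp
    finally have "norm (1 / of_nat (2 * N) *
        (\<Sum>j\<in>{- int N + 1..int N}. f (pi * real_of_int j / real N))
      - integral {-pi..pi} (\<lambda>\<theta>. f \<theta> / complex_of_real (2 * pi))) \<le> r / 2" .
    then show "norm (1 / of_nat (2 * N) *
        (\<Sum>j\<in>{- int N + 1..int N}. f (pi * real_of_int j / real N))
      - integral {-pi..pi} (\<lambda>\<theta>. f \<theta> / complex_of_real (2 * pi))) < r"
      using \<open>r > 0\<close> by linarith
  qed
qed

section \<open>Fourier inversion on the roots of unity\<close>

lemma zeta_powi: "zeta N j powi m = cis (pi * real_of_int m * real_of_int j / real N)"
  by (simp add: zeta_def cis_power_int algebra_simps)

lemma norm_zeta [simp]: "norm (zeta N j) = 1"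
  by (simp add: zeta_def)

text \<open>
  The bound on \<open>m\<close> excludes aliasing: it makes the ratio of the geometric sum a root of unity
  different from \<open>1\<close>.
\<close>

lemma sum_zeta_powi_eq_0:
  assumes "m \<noteq> 0" "\<bar>m\<bar> < 2 * int N"
  shows "(\<Sum>j\<in>{- int N + 1..int N}. zeta N j powi m) = 0"
proof -
  define t where "t = pi * real_of_int m / real N"
  have N: "N > 0" using assms by auto
  have "cis t \<noteq> 1"
  proof
    assume "cis t = 1"
    then obtain l :: int where "t = of_int (2 * l) * pi"
      by (auto simp: cis_conv_exp exp_eq_1)
    then have "real_of_int m = real_of_int (2 * l * int N)"
      using N by (simp add: t_def field_simps)
    then have m: "m = 2 * l * int N" by linarith
    then have "l \<noteq> 0" using assms by auto
    then have "1 * (2 * int N) \<le> \<bar>l\<bar> * (2 * int N)" by (intro mult_right_mono) auto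
    then show False using assms m by (simp add: abs_mult)
  qed
  moreover have "cis t ^ (2 * N) = 1"
  proof -
    have "real (2 * N) * t = 2 * pi * real_of_int m" using N by (simp add: t_def)
    then show ?thesis by (simp only: Complex.DeMoivre) (simp add: cis_multiple_2pi)
  qed
  moreover have "(\<Sum>j\<in>{- int N + 1..int N}. zeta N j powi m)
      = cis (t * (1 - real N)) * (\<Sum>i<2 * N. cis t ^ i)"
    unfolding sum_symmetric_int_interval_eq_sum_nat sum_distrib_left zeta_powi Complex.DeMoivre cis_mult
    by (intro sum.cong refl arg_cong[of _ _ cis]) (simp add: t_def algebra_simps add_divide_distrib diff_divide_distrib)
  ultimately show ?thesis by (simp add: geometric_sum)
qed

text \<open>
  Two frequencies in \<open>[-n, n]\<close> differ by at most \<open>2n < 2N\<close>, so distinct ones are orthogonal on the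
  nodes.
\<close>

lemma trig_coeff_eq_mean:
  assumes "n < N" "\<bar>k\<bar> \<le> int n"
  shows "p k = 1 / of_nat (2 * N) *
           (\<Sum>j\<in>{- int N + 1..int N}. zeta N j powi k * trig_eval n p (zeta N j))"
proof -
  have nz: "zeta N j \<noteq> 0" for j using norm_zeta[of N j] by (metis norm_zero zero_neq_one)
  have "(\<Sum>j\<in>{- int N + 1..int N}. zeta N j powi k * trig_eval n p (zeta N j))
      = (\<Sum>j\<in>{- int N + 1..int N}. \<Sum>l\<in>{- int n..int n}. p l * zeta N j powi (k - l))"
    unfolding trig_eval_def sum_distrib_left
    by (intro sum.cong refl) (simp add: power_int_diff power_int_minus nz field_simps)
  also have "\<dots> = (\<Sum>l\<in>{- int n..int n}. p l * (\<Sum>j\<in>{- int N + 1..int N}. zeta N j powi (k - l)))"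
    unfolding sum_distrib_left by (rule sum.swap)
  also have "\<dots> = (\<Sum>l\<in>{- int n..int n}. if l = k then p k * of_nat (2 * N) else 0)"
  proof (intro sum.cong refl)
    fix l assume "l \<in> {- int n..int n}"
    then have "\<bar>k - l\<bar> < 2 * int N" using assms by auto
    then show "p l * (\<Sum>j\<in>{- int N + 1..int N}. zeta N j powi (k - l))
        = (if l = k then p k * of_nat (2 * N) else 0)"
      using sum_zeta_powi_eq_0[of "k - l" N] assms by (cases "l = k") auto
  qed
  also have "\<dots> = p k * of_nat (2 * N)"
  proof -
    have "k \<in> {- int n..int n}" using assms by auto
    then show ?thesis by simp
  qed
  finally show ?thesis using assms by simp
qed


section \<open>Comparing two sampled moment vectors\<close>

definition coeff_norm :: "nat \<Rightarrow> (int \<Rightarrow> complex) \<Rightarrow> real" where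
  "coeff_norm n p = (\<Sum>k\<in>{- int n..int n}. norm (p k))"

definition sampled_moment :: "nat \<Rightarrow> (complex \<Rightarrow> complex) \<Rightarrow> nat \<Rightarrow> complex" where
  "sampled_moment N F k =
     1 / of_nat (2 * N) * (\<Sum>j\<in>{- int N + 1..int N}. zeta N j ^ k * F (zeta N j))"

lemma coeff_norm_nonneg: "0 \<le> coeff_norm n p"
  by (simp add: coeff_norm_def sum_nonneg)

lemma norm_trig_eval_le_coeff_norm:
  assumes "norm z = 1"
  shows "norm (trig_eval n p z) \<le> coeff_norm n p"
  unfolding trig_eval_def coeff_norm_def
  by (rule sum_norm_le) (simp add: norm_mult norm_power_int assms)

lemma trig_eval_diff: "trig_eval n (\<lambda>k. p k - q k) z = trig_eval n p z - trig_eval n q z"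
  by (simp add: trig_eval_def sum_subtractf left_diff_distrib)

text \<open>
  By Fourier inversion each of the \<open>2n + 1\<close> coefficients is at most the mean of \<open>\<bar>p\<bar>\<close> over the nodes,
  which Cauchy--Schwarz bounds by the root mean square.
\<close>

lemma coeff_norm_squared_le_mean_square:
  assumes "n < N"
  shows "(coeff_norm n p)\<^sup>2 \<le> (2 * real n + 1)\<^sup>2 *
           ((\<Sum>j\<in>{- int N + 1..int N}. (norm (trig_eval n p (zeta N j)))\<^sup>2) / real (2 * N))"
proof -
  let ?J = "{- int N + 1..int N}"
  define m where "m = (\<Sum>j\<in>?J. norm (trig_eval n p (zeta N j))) / real (2 * N)"
  have "norm (p k) \<le> m" if "k \<in> {- int n..int n}" for k
  proof -
    have "norm (p k) = norm (\<Sum>j\<in>?J. zeta N j powi k * trig_eval n p (zeta N j)) / real (2 * N)"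
      using that assms
      by (subst trig_coeff_eq_mean[of n N k p]) (auto simp: norm_mult norm_divide)
    also have "\<dots> \<le> m"
      unfolding m_def
      by (intro divide_right_mono sum_norm_le) (simp_all add: norm_mult norm_power_int)
    finally show ?thesis .
  qed
  then have "coeff_norm n p \<le> of_nat (card {- int n..int n}) * m"
    unfolding coeff_norm_def by (rule sum_bounded_above)
  also have "of_nat (card {- int n..int n}) = 2 * real n + 1" by simp
  finally have "(coeff_norm n p)\<^sup>2 \<le> ((2 * real n + 1) * m)\<^sup>2"
    using coeff_norm_nonneg by (intro power_mono)
  moreover have "m\<^sup>2 \<le> (\<Sum>j\<in>?J. (norm (trig_eval n p (zeta N j)))\<^sup>2) / real (2 * N)"
  proof -
    have "(\<Sum>j\<in>?J. norm (trig_eval n p (zeta N j)))\<^sup>2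
        \<le> (\<Sum>j\<in>?J. (norm (trig_eval n p (zeta N j)))\<^sup>2) * real (2 * N)"
      using sum_squared_le_sum_of_squares[of "\<lambda>j. norm (trig_eval n p (zeta N j))" ?J] by simp
    then show ?thesis using assms by (simp add: m_def power_divide field_simps power2_eq_square)
  qed
  ultimately show ?thesis
    by (smt (verit) mult_left_mono power_mult_distrib zero_le_power2)
qed

text \<open>
  Expanding \<open>p\<close> turns the mean of \<open>F p\<close> into a combination of moments of \<open>F\<close> of orders \<open>-n\<close> to \<open>n\<close>.
  Reality of \<open>F\<close> is what allows control by the nonnegative orders alone: opposite moments are then
  conjugate.
\<close>

lemma norm_mean_mult_trig_eval_le:
  assumes "\<And>j. F (zeta N j) \<in> \<real>"
  shows "norm (1 / of_nat (2 * N) * (\<Sum>j\<in>{- int N + 1..int N}. F (zeta N j) * trig_eval n p (zeta N j)))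
           \<le> coeff_norm n p * (\<Sum>k\<le>n. norm (sampled_moment N F k))"
proof -
  let ?J = "{- int N + 1..int N}"
  define M where "M k = 1 / of_nat (2 * N) * (\<Sum>j\<in>?J. zeta N j powi (- k) * F (zeta N j))" for k
  have cnj_zeta: "cnj (zeta N j) powi k = zeta N j powi (- k)" for j k
  proof -
    have "cnj (zeta N j) powi k = cnj (zeta N j powi k)" by simp
    then show ?thesis by (simp only: zeta_powi cis_cnj) simp
  qed
  have cnj_M: "cnj (M k) = M (- k)" for k
    using assms by (simp add: M_def cnj_zeta Reals_cnj_iff)
  have norm_M: "norm (M (- k)) = norm (M k)" for k
    by (metis cnj_M complex_mod_cnj)
  have M_neg: "M (- int k) = sampled_moment N F k" for k
    by (simp add: M_def sampled_moment_def)
  have M_le: "norm (M k) \<le> (\<Sum>k\<le>n. norm (sampled_moment N F k))"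
    if "k \<in> {- int n..int n}" for k
  proof -
    have "norm (M k) = norm (M (- int (nat \<bar>k\<bar>)))"
      using norm_M[of k] by (cases "k \<ge> 0") auto
    also have "\<dots> = norm (sampled_moment N F (nat \<bar>k\<bar>))" by (simp only: M_neg)
    also have "\<dots> \<le> (\<Sum>k\<le>n. norm (sampled_moment N F k))"
      using that by (intro member_le_sum) auto
    finally show ?thesis .
  qed
  have "(\<Sum>j\<in>?J. F (zeta N j) * trig_eval n p (zeta N j))
      = (\<Sum>j\<in>?J. \<Sum>k\<in>{- int n..int n}. p k * (zeta N j powi (- k) * F (zeta N j)))"
    by (simp add: trig_eval_def sum_distrib_left mult_ac)
  also have "\<dots> = (\<Sum>k\<in>{- int n..int n}. p k * (\<Sum>j\<in>?J. zeta N j powi (- k) * F (zeta N j)))"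
    unfolding sum_distrib_left by (rule sum.swap)
  finally have "1 / of_nat (2 * N) * (\<Sum>j\<in>?J. F (zeta N j) * trig_eval n p (zeta N j))
      = (\<Sum>k\<in>{- int n..int n}. p k * M k)"
    by (simp add: M_def sum_distrib_left mult_ac)
  also have "norm \<dots> \<le> (\<Sum>k\<in>{- int n..int n}.
      norm (p k) * (\<Sum>k\<le>n. norm (sampled_moment N F k)))"
    by (intro sum_norm_le) (auto simp: norm_mult intro!: mult_left_mono M_le)
  also have "\<dots> = coeff_norm n p * (\<Sum>k\<le>n. norm (sampled_moment N F k))"
    by (simp add: coeff_norm_def sum_distrib_right)
  finally show ?thesis .
qed

text \<open>
  The stability estimate that carries the proof: denominators with nearby sampled moments have nearby
  coefficients.  The difference \<open>S\<close> occurs also on the right, through the upper bound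
  \<open>R \<le> B + S\<close> at the nodes, so that only \<open>Q\<close> and not \<open>R\<close> enters the constants.
\<close>

lemma coeff_norm_diff_le_moment_diff:
  assumes "n < N" and P: "P \<in> trig_polys n"
    and Q: "Q \<in> trig_pos_disc n N" and R: "R \<in> trig_pos_disc n N"
    and m: "m > 0" "\<And>j. j \<in> {- int N + 1..int N} \<Longrightarrow> m \<le> Re (trig_eval n P (zeta N j))"
  defines "S \<equiv> coeff_norm n (\<lambda>k. Q k - R k)" and "B \<equiv> coeff_norm n Q"
  shows "m * S \<le> (2 * real n + 1)\<^sup>2 * B * (B + S) *
           (\<Sum>k\<le>n. norm (sampled_moment N (\<lambda>z. trig_eval n P z / trig_eval n R z) k
                        - sampled_moment N (\<lambda>z. trig_eval n P z / trig_eval n Q z) k))"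
    (is "_ \<le> _ * ?\<delta>")
proof (cases "S = 0")
  case True
  then show ?thesis using coeff_norm_nonneg by (simp add: B_def sum_nonneg)
next
  case False
  then have S: "S > 0" using coeff_norm_nonneg by (simp add: S_def order_less_le)
  let ?J = "{- int N + 1..int N}"
  define D where "D = (\<lambda>k. Q k - R k)"
  define F where "F z = trig_eval n P z / trig_eval n R z - trig_eval n P z / trig_eval n Q z" for z
  have QR: "Q \<in> trig_polys n" "R \<in> trig_polys n" using Q R by (auto simp: trig_pos_disc_def)
  have real_vals: "trig_eval n p (zeta N j) = of_real (Re (trig_eval n p (zeta N j)))"
    if "p \<in> trig_polys n" for p j
    using trig_eval_real[OF that, of "zeta N j"] by (simp add: of_real_Re)
  have F_real: "F (zeta N j) \<in> \<real>" for j
    using trig_eval_real[of _ n "zeta N j"] P QR by (auto simp: F_def)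
  have "0 \<in> ?J" using \<open>n < N\<close> by auto
  then have "0 < Re (trig_eval n Q (zeta N 0))" using Q unfolding trig_pos_disc_def by blast
  also have "\<dots> \<le> B"
    unfolding B_def by (meson complex_Re_le_cmod norm_trig_eval_le_coeff_norm norm_zeta order_trans)
  finally have B: "B > 0" .
  \<comment> \<open>\<open>F D = P D\<^sup>2 / (Q R)\<close> at the nodes, and there \<open>Q R \<le> B (B + S)\<close>.\<close>
  have lower: "m / (B * (B + S)) * (norm (trig_eval n D (zeta N j)))\<^sup>2
      \<le> Re (F (zeta N j) * trig_eval n D (zeta N j))" if j: "j \<in> ?J" for j
  proof -
    define x q r where "x = Re (trig_eval n P (zeta N j))"
      and "q = Re (trig_eval n Q (zeta N j))" and "r = Re (trig_eval n R (zeta N j))"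
    have vals: "trig_eval n P (zeta N j) = of_real x" "trig_eval n Q (zeta N j) = of_real q"
      "trig_eval n R (zeta N j) = of_real r"
      unfolding x_def q_def r_def by (rule real_vals; use P QR in simp)+
    have pos: "q > 0" "r > 0" "m \<le> x"
      using Q R m(2)[OF j] j by (auto simp: trig_pos_disc_def q_def r_def x_def)
    have D: "trig_eval n D (zeta N j) = of_real (q - r)"
      by (simp add: D_def trig_eval_diff vals)
    have "q \<le> B"
      using norm_trig_eval_le_coeff_norm[of "zeta N j" n Q] by (simp add: vals B_def)
    moreover have "\<bar>q - r\<bar> \<le> S"
      using norm_trig_eval_le_coeff_norm[of "zeta N j" n D] unfolding D norm_of_real
      by (simp add: S_def D_def)
    ultimately have "q * r \<le> B * (B + S)"
      using pos by (intro mult_mono) auto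
    then have "m / (B * (B + S)) \<le> x / (q * r)"
      using pos m(1) by (intro frac_le) auto
    then have "m / (B * (B + S)) * (q - r)\<^sup>2 \<le> x / (q * r) * (q - r)\<^sup>2"
      by (rule mult_right_mono) simp
    also have "\<dots> = (x / r - x / q) * (q - r)"
      using pos by (simp add: field_simps power2_eq_square)
    finally show ?thesis
      unfolding D norm_of_real by (simp add: F_def vals flip: of_real_diff of_real_divide of_real_mult)
  qed
  define A where "A = (\<Sum>j\<in>?J. (norm (trig_eval n D (zeta N j)))\<^sup>2) / real (2 * N)"
  have "m / (B * (B + S)) * A
      = (\<Sum>j\<in>?J. m / (B * (B + S)) * (norm (trig_eval n D (zeta N j)))\<^sup>2) / real (2 * N)"
    by (simp add: A_def sum_distrib_left)
  also have "\<dots> \<le> (\<Sum>j\<in>?J. Re (F (zeta N j) * trig_eval n D (zeta N j))) / real (2 * N)"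
    by (intro divide_right_mono sum_mono lower) auto
  also have "\<dots> = Re (1 / of_nat (2 * N) * (\<Sum>j\<in>?J. F (zeta N j) * trig_eval n D (zeta N j)))"
  proof -
    have "(1 / of_nat (2 * N) :: complex) = of_real (1 / real (2 * N))" by simp
    then show ?thesis by (simp only: Re_complex_of_real Re_sum) (simp flip: of_real_mult)
  qed
  also have "\<dots> \<le> S * (\<Sum>k\<le>n. norm (sampled_moment N F k))"
    using norm_mean_mult_trig_eval_le[of F N n D] F_real complex_Re_le_cmod
    unfolding S_def D_def by (meson order_trans)
  also have "(\<Sum>k\<le>n. norm (sampled_moment N F k)) = ?\<delta>"
    by (simp add: sampled_moment_def F_def right_diff_distrib sum_subtractf)
  finally have "m * A / (B * (B + S)) \<le> S * ?\<delta>" by simp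
  then have upper: "m * A \<le> S * ?\<delta> * (B * (B + S))"
    using B S by (subst (asm) pos_divide_le_eq) simp_all
  have "S\<^sup>2 \<le> (2 * real n + 1)\<^sup>2 * A"
    using coeff_norm_squared_le_mean_square[OF \<open>n < N\<close>, of D] by (simp add: S_def A_def D_def)
  then have "m * S\<^sup>2 \<le> (2 * real n + 1)\<^sup>2 * (m * A)"
    using m(1) by (simp add: mult_left_mono mult.left_commute)
  also have "\<dots> \<le> (2 * real n + 1)\<^sup>2 * (S * ?\<delta> * (B * (B + S)))"
    by (intro mult_left_mono upper) simp
  \<comment> \<open>Both sides carry a factor \<open>S\<close>, on the right because \<open>F\<close> was tested against \<open>D\<close>; cancelling
    it leaves an inequality that is linear in \<open>S\<close> on both sides.\<close>
  finally have "S * (m * S) \<le> S * ((2 * real n + 1)\<^sup>2 * B * (B + S) * ?\<delta>)"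
    by (simp add: power2_eq_square mult_ac)
  then show ?thesis using S by (simp only: mult_le_cancel_left_pos)
qed

section \<open>Convergence\<close>

lemma continuous_on_trig_eval_cis [continuous_intros]:
  "continuous_on A (\<lambda>\<theta>. trig_eval n p (cis \<theta>))"
  unfolding trig_eval_def cis_power_int by (intro continuous_intros)

lemma zeta_eq_cis:
  assumes "N > 0" "j \<in> {- int N + 1..int N}"
  shows "\<exists>\<theta>\<in>{-pi..pi}. zeta N j = cis \<theta>"
proof
  define t where "t = real_of_int j / real N"
  have "-1 \<le> t" "t \<le> 1" using assms by (auto simp: t_def divide_simps)
  then have "pi * (-1) \<le> pi * t" "pi * t \<le> pi * 1" by (intro mult_left_mono; simp)+
  then show "pi * t \<in> {-pi..pi}" by simp
  show "zeta N j = cis (pi * t)" by (simp add: zeta_def t_def)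
qed

lemma trig_pos_subset_trig_pos_disc:
  assumes "N > 0"
  shows "trig_pos n \<subseteq> trig_pos_disc n N"
proof
  fix p assume p: "p \<in> trig_pos n"
  have "Re (trig_eval n p (zeta N j)) > 0" if j: "j \<in> {- int N + 1..int N}" for j
  proof -
    obtain \<theta> where "\<theta> \<in> {-pi..pi}" "zeta N j = cis \<theta>"
      using zeta_eq_cis[OF assms j] by blast
    then show ?thesis using p by (simp add: trig_pos_def)
  qed
  then show "p \<in> trig_pos_disc n N" using p by (simp add: trig_pos_def trig_pos_disc_def)
qed

lemma trig_pos_lower_bound:
  assumes "P \<in> trig_pos n"
  shows "\<exists>m>0. \<forall>\<theta>\<in>{-pi..pi}. m \<le> Re (trig_eval n P (cis \<theta>))"
proof -
  have "continuous_on {-pi..pi} (\<lambda>\<theta>. Re (trig_eval n P (cis \<theta>)))"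
    by (intro continuous_intros)
  then have "\<exists>\<phi>\<in>{-pi..pi}. \<forall>\<theta>\<in>{-pi..pi}. Re (trig_eval n P (cis \<phi>)) \<le> Re (trig_eval n P (cis \<theta>))"
    by (intro continuous_attains_inf) auto
  then obtain \<phi> where "\<phi> \<in> {-pi..pi}"
    "\<forall>\<theta>\<in>{-pi..pi}. Re (trig_eval n P (cis \<phi>)) \<le> Re (trig_eval n P (cis \<theta>))"
    by blast
  moreover from this(1) have "Re (trig_eval n P (cis \<phi>)) > 0"
    using assms by (simp add: trig_pos_def)
  ultimately show ?thesis by blast
qed

lemma sampled_moment_tendsto:
  assumes "Q \<in> trig_pos n"
  shows "(\<lambda>N. sampled_moment N (\<lambda>z. trig_eval n P z / trig_eval n Q z) k)
     \<longlonglongrightarrow> integral {-pi..pi} (\<lambda>\<theta>. cis (real k * \<theta>) *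
                 (trig_eval n P (cis \<theta>) / trig_eval n Q (cis \<theta>)) / complex_of_real (2 * pi))"
proof -
  have "trig_eval n Q (cis \<theta>) \<noteq> 0" if "\<theta> \<in> {-pi..pi}" for \<theta>
    using assms that by (force simp: trig_pos_def)
  then have "continuous_on {-pi..pi}
      (\<lambda>\<theta>. cis (real k * \<theta>) * (trig_eval n P (cis \<theta>) / trig_eval n Q (cis \<theta>)))"
    by (intro continuous_intros) auto
  from equispaced_mean_tendsto_integral[OF this] show ?thesis
    by (simp add: sampled_moment_def zeta_def Complex.DeMoivre)
qed


lemma tendsto_fun_iff:
  fixes f :: "'a \<Rightarrow> 'b \<Rightarrow> 'c::topological_space"
  shows "(f \<longlongrightarrow> l) F \<longleftrightarrow> (\<forall>k. ((\<lambda>x. f x k) \<longlongrightarrow> l k) F)"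
  using limitin_componentwise[of "\<lambda>_. euclidean" UNIV f l F]
  by (simp add: euclidean_product_topology)

lemma tendsto_if_coeff_norm_diff_tendsto_0:
  assumes "p \<in> trig_polys n" and "eventually (\<lambda>x. f x \<in> trig_polys n) F"
    and "((\<lambda>x. coeff_norm n (\<lambda>k. p k - f x k)) \<longlongrightarrow> 0) F"
  shows "(f \<longlongrightarrow> p) F"
  unfolding tendsto_fun_iff
proof
  fix k
  have "eventually (\<lambda>x. norm (f x k - p k) \<le> coeff_norm n (\<lambda>k. p k - f x k)) F"
    using assms(2)
  proof eventually_elim
    case (elim x)
    show ?case
    proof (cases "\<bar>k\<bar> \<le> int n")
      case True
      then show ?thesis
        unfolding coeff_norm_def
        by (subst norm_minus_commute, intro member_le_sum[of k _ "\<lambda>k. norm (p k - f x k)"]) auto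
    next
      case False
      then have "f x k = 0" "p k = 0" using elim assms(1) by (auto simp: trig_polys_def)
      then show ?thesis by (simp add: coeff_norm_nonneg)
    qed
  qed
  from Lim_null_comparison[OF this assms(3)] show "((\<lambda>x. f x k) \<longlongrightarrow> p k) F"
    by (subst LIM_zero_iff[symmetric])
qed

theorem theorem6:
  fixes n N0 :: nat and c :: "nat \<Rightarrow> complex" and P Q :: "int \<Rightarrow> complex"
    and QN :: "nat \<Rightarrow> int \<Rightarrow> complex"
  assumes "n \<ge> 1"
    and "c \<in> dual_pos n"
    and "P \<in> trig_pos n"
    and "N0 > n"
    and "\<forall>N\<ge>N0. c \<in> dual_pos_disc n N"
    and "\<forall>N\<ge>N0. QN N \<in> trig_pos_disc n N \<and> solves_moments_disc n N c P (QN N)"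
    and "Q \<in> trig_pos n" and "solves_moments n c P Q"
  shows "QN \<longlonglongrightarrow> Q"
proof -
  define \<delta> where "\<delta> N = (\<Sum>k\<le>n. norm (c k
      - sampled_moment N (\<lambda>z. trig_eval n P z / trig_eval n Q z) k))" for N
  define S where "S N = coeff_norm n (\<lambda>k. Q k - QN N k)" for N
  define B where "B = coeff_norm n Q"
  define A where "A = (2 * real n + 1)\<^sup>2 * B"
  have "(\<lambda>N. sampled_moment N (\<lambda>z. trig_eval n P z / trig_eval n Q z) k) \<longlonglongrightarrow> c k"
    if "k \<le> n" for k
    using sampled_moment_tendsto[OF \<open>Q \<in> trig_pos n\<close>, of P k] \<open>solves_moments n c P Q\<close> that
    by (simp add: solves_moments_def)
  then have "\<delta> \<longlonglongrightarrow> (\<Sum>k\<le>n. norm (c k - c k))"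
    unfolding \<delta>_def by (intro tendsto_intros) auto
  then have \<delta>: "\<delta> \<longlonglongrightarrow> 0" by simp
  obtain m where m: "m > 0" "\<forall>\<theta>\<in>{-pi..pi}. m \<le> Re (trig_eval n P (cis \<theta>))"
    using trig_pos_lower_bound[OF \<open>P \<in> trig_pos n\<close>] by blast
  have estimate: "m * S N \<le> A * (B + S N) * \<delta> N" if "N \<ge> N0" for N
  proof -
    have N: "n < N" "N > 0" using that \<open>N0 > n\<close> by auto
    have "c k = sampled_moment N (\<lambda>z. trig_eval n P z / trig_eval n (QN N) z) k" if "k \<le> n" for k
      using assms(6) \<open>N \<ge> N0\<close> that by (simp add: solves_moments_disc_def sampled_moment_def)
    then have \<delta>_eq: "\<delta> N = (\<Sum>k\<le>n. norm (sampled_moment N (\<lambda>z. trig_eval n P z / trig_eval n (QN N) z) k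
        - sampled_moment N (\<lambda>z. trig_eval n P z / trig_eval n Q z) k))"
      unfolding \<delta>_def by (intro sum.cong) auto
    have m_le: "m \<le> Re (trig_eval n P (zeta N j))" if j: "j \<in> {- int N + 1..int N}" for j
    proof -
      obtain \<theta> where "\<theta> \<in> {-pi..pi}" "zeta N j = cis \<theta>"
        using zeta_eq_cis[OF N(2) j] by blast
      then show ?thesis using m(2) by simp
    qed
    have Q: "Q \<in> trig_pos_disc n N"
      using trig_pos_subset_trig_pos_disc[OF N(2)] \<open>Q \<in> trig_pos n\<close> by blast
    have R: "QN N \<in> trig_pos_disc n N" using assms(6) that by blast
    have P: "P \<in> trig_polys n" using \<open>P \<in> trig_pos n\<close> by (simp add: trig_pos_def)
    show ?thesis
      unfolding \<delta>_eq S_def A_def B_def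
      using coeff_norm_diff_le_moment_diff[OF N(1) P Q R m(1) m_le] .
  qed
  \<comment> \<open>Once \<open>A * \<delta> N < m / 2\<close>, the term \<open>A * S N * \<delta> N\<close> of the estimate is absorbed into half of
    its left side.\<close>
  have "(\<lambda>N. A * \<delta> N) \<longlonglongrightarrow> A * 0" by (intro tendsto_intros \<delta>)
  then have "eventually (\<lambda>N. A * \<delta> N < m / 2) sequentially"
    using m(1) by (auto dest: order_tendstoD(2)[of _ _ _ "m / 2"])
  then have bound: "eventually (\<lambda>N. norm (S N) \<le> 2 * A * B / m * \<delta> N) sequentially"
    using eventually_ge_at_top[of N0]
  proof eventually_elim
    case (elim N)
    have "0 \<le> S N" by (simp add: S_def coeff_norm_nonneg)
    then have "A * \<delta> N * S N \<le> m / 2 * S N" using elim by (intro mult_right_mono) auto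
    then have "m / 2 * S N \<le> A * B * \<delta> N"
      using estimate[OF elim(2)] by (simp add: algebra_simps)
    then show ?case using m(1) \<open>0 \<le> S N\<close> by (simp add: field_simps)
  qed
  have "(\<lambda>N. 2 * A * B / m * \<delta> N) \<longlonglongrightarrow> 2 * A * B / m * 0" by (intro tendsto_intros \<delta>)
  then have "S \<longlonglongrightarrow> 0" using Lim_null_comparison[OF bound] by simp
  moreover have "eventually (\<lambda>N. QN N \<in> trig_polys n) sequentially"
    using eventually_ge_at_top[of N0] by eventually_elim (use assms(6) in \<open>auto simp: trig_pos_disc_def\<close>)
  ultimately show ?thesis
    using \<open>Q \<in> trig_pos n\<close> unfolding S_def
    by (intro tendsto_if_coeff_norm_diff_tendsto_0) (auto simp: trig_pos_def)
qed

end
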